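(* Let $T>0$, $I=[-T,T]$, $m\in\mathbb{R}$ with $m\ne k\pi/T$ for all $k\in\mathbb{Z}$, $\alpha:=mT$, and let $\overline{G}$ be the Green's function of the problem $x'(t)+m\,x(-t)=h(t)$, $t\in I$, $x(T)=x(-T)$ (with values on the diagonal of $I^2$ fixed by the convention in the context). Let $P:=\{(-T,-T),(0,0),(T,T),(T,-T)\}$. Then: 1. If $\alpha\in(0,\frac{\pi}{4})$, then $\overline G$ is strictly positive on $I^2$. 2. If $\alpha\in(-\frac{\pi}{4},0)$, then $\overline G$ is strictly negative on $I^2$. 3. If $\alpha=\frac{\pi}{4}$, then $\overline G$ vanishes on $P$ and is strictly positive on $I^2\setminus P$. 4. If $\alpha=-\frac{\pi}{4}$, then $\overline G$ vanishes on $P$ and is strictly negative on $I^2\setminus P$. 5. If $\alpha\in\mathbb{R}\setminus[-\frac{\pi}{4},\frac{\pi}{4}]$, then $\overline G$ is neither positive nor negative on $I^2$.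
   Context: Points of $I^2$ are written $(t,s)$. Let $G:I^2\to\mathbb R$ be the Green's function of the periodic problem $x''+m^2x=f$ on $I$, $x(T)=x(-T)$, $x'(T)=x'(-T)$, i.e. the continuous function such that for each continuous $f$ the unique solution is $\int_{-T}^{T}G(t,s)f(s)\,ds$; explicitly $2m\sin(mT)\,G(t,s)=\cos m(T+s-t)$ if $s\le t$ and $=\cos m(T-s+t)$ if $s>t$. The Green's function of the first order problem is $\overline{G}(t,s):=m\,G(t,-s)-\frac{\partial G}{\partial s}(t,s)$ for $t\ne s$; the unique solution of that problem with $h\in L^1(I)$ is $u(t)=\int_{-T}^{T}\overline G(t,s)h(s)\,ds$. On the diagonal it is defined, for $t\in(-T,T)$, by $\overline G(t,t)=\lim_{s\to t^+}\overline G(t,s)$ if $m>0$ and $\overline G(t,t)=\lim_{s\to t^-}\overline G(t,s)$ if $m<0$, and $\overline G(T,T)=\lim_{s\to T^-}\overline G(s,s)$, $\overline G(-T,-T)=\lim_{s\to -T^+}\overline G(s,s)$.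
   Formalization: Item 4 is false as stated: for α = −π/4 one has Ḡ(T,−T) = −1 and Ḡ(−T,T) = 0. It is proved with P replaced by {(−T,−T),(0,0),(T,T),(−T,T)}; item 3 keeps P. *)

theory Defs
  imports "HOL-Analysis.Analysis"
begin

text \<open>
  Classical solutions on \<open>[-T, T]\<close> of \<open>x'' + m\<^sup>2 x = f\<close>, \<open>x(T) = x(-T)\<close>,
  \<open>x'(T) = x'(-T)\<close>. Derivatives are relative to the interval, hence one-sided at its endpoints.
\<close>

definition periodic_solution :: "real \<Rightarrow> real \<Rightarrow> (real \<Rightarrow> real) \<Rightarrow> (real \<Rightarrow> real) \<Rightarrow> bool" where
  "periodic_solution T m f x \<longleftrightarrow>
     (\<exists>x' x''.
        (\<forall>t\<in>{-T..T}. (x has_real_derivative x' t) (at t within {-T..T}) \<and>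
                     (x' has_real_derivative x'' t) (at t within {-T..T}) \<and>
                     x'' t + m^2 * x t = f t) \<and>
        x T = x (-T) \<and> x' T = x' (-T))"

text \<open>
  The equivalence in the last conjunct says both that the integral is a solution and that, on
  \<open>[-T, T]\<close>, it is the only one. Membership in \<^const>\<open>extensional\<close> only fixes
  the irrelevant values outside the square, so that the definite description below is unique.
\<close>

definition is_periodic_green :: "real \<Rightarrow> real \<Rightarrow> (real \<times> real \<Rightarrow> real) \<Rightarrow> bool" where
  "is_periodic_green T m G \<longleftrightarrow>
     G \<in> extensional ({-T..T} \<times> {-T..T}) \<and>
     continuous_on ({-T..T} \<times> {-T..T}) G \<and>
     (\<forall>f. continuous_on {-T..T} f \<longrightarrow>
        (\<forall>x. periodic_solution T m f x \<longleftrightarrow>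
           (\<forall>t\<in>{-T..T}. x t = integral {-T..T} (\<lambda>s. G (t, s) * f s))))"

definition periodic_green :: "real \<Rightarrow> real \<Rightarrow> real \<times> real \<Rightarrow> real" where
  "periodic_green T m = (THE G. is_periodic_green T m G)"

text \<open>
  The Green's function of \<open>x'(t) + m x(-t) = h(t)\<close>, \<open>x(T) = x(-T)\<close>. Off the diagonal it is
  \<open>m G(t, -s) - \<partial>G/\<partial>s (t, s)\<close>; the partial derivative is relative to \<open>[-T, T]\<close>, hence
  one-sided for \<open>s = T\<close> and \<open>s = -T\<close>.
\<close>

definition refl_green_offdiag :: "real \<Rightarrow> real \<Rightarrow> real \<Rightarrow> real \<Rightarrow> real" where
  "refl_green_offdiag T m t s =
     m * periodic_green T m (t, -s)
       - vector_derivative (\<lambda>r. periodic_green T m (t, r)) (at s within {-T..T})"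

definition refl_green_diag :: "real \<Rightarrow> real \<Rightarrow> real \<Rightarrow> real" where
  "refl_green_diag T m t =
     (if m > 0 then Lim (at_right t) (\<lambda>s. refl_green_offdiag T m t s)
      else Lim (at_left t) (\<lambda>s. refl_green_offdiag T m t s))"

definition refl_green :: "real \<Rightarrow> real \<Rightarrow> real \<times> real \<Rightarrow> real" where
  "refl_green T m = (\<lambda>(t, s).
     if t \<noteq> s then refl_green_offdiag T m t s
     else if t = T then Lim (at_left T) (refl_green_diag T m)
     else if t = -T then Lim (at_right (-T)) (refl_green_diag T m)
     else refl_green_diag T m t)"

text \<open>
  The zero set of the Green's function for \<open>mT = \<pi>/4\<close>. Replacing \<open>m\<close> by \<open>-m\<close> turns the
  Green's function \<open>g(t, s)\<close> into \<open>-g(-t, -s)\<close>, so that for \<open>mT = -\<pi>/4\<close> the zero set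
  is the reflection of this one through the origin: the off-diagonal corner is \<open>(-T, T)\<close>
  instead of \<open>(T, -T)\<close>. The value at \<open>(T, -T)\<close> is \<open>(cot (mT) - 1) / 2\<close>, which is \<open>-1\<close>
  for \<open>mT = -\<pi>/4\<close>.
\<close>

definition zero_points :: "real \<Rightarrow> (real \<times> real) set" where
  "zero_points T = {(-T, -T), (0, 0), (T, T), (T, -T)}"

definition zero_points_refl :: "real \<Rightarrow> (real \<times> real) set" where
  "zero_points_refl T = {(-T, -T), (0, 0), (T, T), (-T, T)}"

end

theory Submission
  imports Defs
begin

text \<open>
  The sign can be read off a closed form. The Green's function of the periodic problem is
  \<open>cos (m (T - \<bar>t - s\<bar>)) / (2 m sin (m T))\<close>: its integral against \<open>f\<close> solves the problem
  (\<open>periodic_solution_integral_cos_green\<close>), and since \<open>sin (m T) \<noteq> 0\<close> the homogeneous problem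
  has only the zero solution (\<open>periodic_solution_unique\<close>). A continuous kernel is determined by its
  integrals against continuous functions, so the definite description picks out this function
  (\<open>periodic_green_eq\<close>).

  Differentiating in \<open>s\<close> and taking the limits at the diagonal gives the Green's function of the
  problem with reflection (\<open>refl_green_eq_refl_kernel\<close>). Up to the factor \<open>2 sin (m T)\<close> it is
  \<open>cos x + sin y\<close>, where \<open>\<bar>x\<bar>, \<bar>y\<bar> \<le> \<bar>m\<bar> T\<close> for all points of the square. Now
  \<open>cos x + sin y = cos \<bar>x\<bar> - cos (y + \<pi>/2)\<close>, and for \<open>0 < m T \<le> \<pi>/4\<close> the arguments satisfy
  \<open>\<bar>x\<bar> \<le> \<pi>/4 \<le> y + \<pi>/2\<close>, so the monotonicity of the cosine on \<open>[0, \<pi>]\<close> gives nonnegativity.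
  Equality forces \<open>m T = \<pi>/4\<close>, \<open>\<bar>x\<bar> = \<pi>/4\<close> and \<open>y = -\<pi>/4\<close>, which are the four points of
  \<open>zero_points\<close> (\<open>refl_kernel_nonneg\<close>). If \<open>m T > \<pi>/4\<close>, two explicit points have opposite signs
  (\<open>refl_kernel_changes_sign\<close>). Negative \<open>m\<close> reduces to positive \<open>m\<close> by the symmetry
  \<open>refl_kernel_minus\<close>.
\<close>

section \<open>The periodic Green's function in closed form\<close>

definition cos_green :: "real \<Rightarrow> real \<Rightarrow> real \<times> real \<Rightarrow> real" where
  "cos_green T m = (\<lambda>(t, s). cos (m * (T - \<bar>t - s\<bar>)) / (2 * m * sin (m * T)))"

lemma continuous_on_cos_green: "continuous_on A (cos_green T m)"
proof -
  have "continuous_on A (\<lambda>p. cos (m * (T - \<bar>fst p - snd p\<bar>)) * c)" for c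
    by (rule continuous_intros)+
  then show ?thesis
    unfolding cos_green_def case_prod_unfold divide_inverse .
qed

text \<open>
  On either side of \<open>s = t\<close> the addition theorems separate the variables \<open>t\<close> and \<open>s\<close> in the kernel.
  The integral thus becomes an expression in the primitives of \<open>cos (m s) f s\<close> and
  \<open>sin (m s) f s\<close>, which can be differentiated by the product rule alone, without differentiating
  under the integral sign.
\<close>

lemma integral_cos_green:
  fixes f :: "real \<Rightarrow> real" and m T t :: real
  defines "C \<equiv> \<lambda>u. integral {-T..u} (\<lambda>s. cos (m * s) * f s)"
    and "S \<equiv> \<lambda>u. integral {-T..u} (\<lambda>s. sin (m * s) * f s)"
  assumes f: "continuous_on {-T..T} f" and t: "t \<in> {-T..T}"
  shows "integral {-T..T} (\<lambda>s. cos_green T m (t, s) * f s) =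
    (cos (m * (T - t)) * C t - sin (m * (T - t)) * S t
     + cos (m * (T + t)) * (C T - C t) + sin (m * (T + t)) * (S T - S t)) / (2 * m * sin (m * T))"
proof -
  let ?k = "2 * m * sin (m * T)"
  let ?c = "\<lambda>s. cos (m * s) * f s" and ?s = "\<lambda>s. sin (m * s) * f s"
  have cont: "continuous_on {-T..T} ?c" "continuous_on {-T..T} ?s"
    using f by (auto intro!: continuous_intros)
  have int: "?c integrable_on {a..b}" "?s integrable_on {a..b}" if "-T \<le> a" "b \<le> T" for a b
    using that cont by (auto intro!: integrable_continuous_real continuous_on_subset[of "{-T..T}"])
  have l: "(?c has_integral C t) {-T..t}" "(?s has_integral S t) {-T..t}"
    unfolding C_def S_def using t int by (auto intro!: integrable_integral)
  have "C t + integral {t..T} ?c = C T" "S t + integral {t..T} ?s = S T"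
    unfolding C_def S_def using t int by (auto intro!: Henstock_Kurzweil_Integration.integral_combine)
  then have r: "(?c has_integral C T - C t) {t..T}" "(?s has_integral S T - S t) {t..T}"
    using t int[of t T] by (auto simp: has_integral_iff)
  have "((\<lambda>s. (cos (m * (T - t)) * ?c s - sin (m * (T - t)) * ?s s) / ?k) has_integral
      (cos (m * (T - t)) * C t - sin (m * (T - t)) * S t) / ?k) {-T..t}"
    by (intro has_integral_divide has_integral_diff has_integral_mult_right l)
  then have L: "((\<lambda>s. cos_green T m (t, s) * f s) has_integral
      (cos (m * (T - t)) * C t - sin (m * (T - t)) * S t) / ?k) {-T..t}"
  proof (rule has_integral_eq[rotated])
    fix s assume "s \<in> {-T..t}"
    then have "cos (m * (T - \<bar>t - s\<bar>)) = cos (m * (T - t) + m * s)" by (simp add: algebra_simps)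
    then show "(cos (m * (T - t)) * ?c s - sin (m * (T - t)) * ?s s) / ?k = cos_green T m (t, s) * f s"
      unfolding cos_green_def by (simp add: cos_add left_diff_distrib mult.assoc)
  qed
  have "((\<lambda>s. (cos (m * (T + t)) * ?c s + sin (m * (T + t)) * ?s s) / ?k) has_integral
      (cos (m * (T + t)) * (C T - C t) + sin (m * (T + t)) * (S T - S t)) / ?k) {t..T}"
    by (intro has_integral_divide has_integral_add has_integral_mult_right r)
  then have R: "((\<lambda>s. cos_green T m (t, s) * f s) has_integral
      (cos (m * (T + t)) * (C T - C t) + sin (m * (T + t)) * (S T - S t)) / ?k) {t..T}"
  proof (rule has_integral_eq[rotated])
    fix s assume "s \<in> {t..T}"
    then have "cos (m * (T - \<bar>t - s\<bar>)) = cos (m * (T + t) - m * s)" by (simp add: algebra_simps)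
    then show "(cos (m * (T + t)) * ?c s + sin (m * (T + t)) * ?s s) / ?k = cos_green T m (t, s) * f s"
      unfolding cos_green_def by (simp add: cos_diff distrib_right mult.assoc)
  qed
  from t have "-T \<le> t" "t \<le> T" by auto
  from has_integral_combine[OF this L R] show ?thesis
    by (simp add: has_integral_iff add_divide_distrib)
qed

text \<open>
  In each derivative of the representation above, the terms in which a primitive is differentiated
  contribute \<open>f t\<close> times the jump of the kernel, respectively of its \<open>t\<close>-derivative, across the
  diagonal. The first jump is \<open>0\<close> because the kernel is continuous; the second is \<open>1\<close>, which produces
  the right-hand side \<open>f\<close>.
\<close>

lemma periodic_solution_integral_cos_green:
  fixes f :: "real \<Rightarrow> real"
  assumes T: "T > 0" and ns: "sin (m * T) \<noteq> 0" and f: "continuous_on {-T..T} f"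
  shows "periodic_solution T m f (\<lambda>t. integral {-T..T} (\<lambda>s. cos_green T m (t, s) * f s))"
proof -
  define C where "C = (\<lambda>u. integral {-T..u} (\<lambda>s. cos (m * s) * f s))"
  define S where "S = (\<lambda>u. integral {-T..u} (\<lambda>s. sin (m * s) * f s))"
  let ?I = "{-T..T}"
  from ns have m: "m \<noteq> 0" by auto
  define x where "x = (\<lambda>t. (cos (m * (T - t)) * C t - sin (m * (T - t)) * S t
     + cos (m * (T + t)) * (C T - C t) + sin (m * (T + t)) * (S T - S t)) / (2 * m * sin (m * T)))"
  define x' where "x' = (\<lambda>t. (sin (m * (T - t)) * C t + cos (m * (T - t)) * S t
     - sin (m * (T + t)) * (C T - C t) + cos (m * (T + t)) * (S T - S t)) / (2 * sin (m * T)))"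
  have x: "integral ?I (\<lambda>s. cos_green T m (t, s) * f s) = x t" if "t \<in> ?I" for t
    unfolding x_def C_def S_def by (rule integral_cos_green[OF f that])
  have dC: "(C has_real_derivative cos (m * t) * f t) (at t within ?I)" if "t \<in> ?I" for t
    unfolding C_def using that f by (intro integral_has_real_derivative continuous_intros) auto
  have dS: "(S has_real_derivative sin (m * t) * f t) (at t within ?I)" if "t \<in> ?I" for t
    unfolding S_def using that f by (intro integral_has_real_derivative continuous_intros) auto
  have dx: "(x has_real_derivative x' t) (at t within ?I)" if t: "t \<in> ?I" for t
  proof -
    let ?j = "cos (m * (T - t)) * cos (m * t) - sin (m * (T - t)) * sin (m * t)
       - cos (m * (T + t)) * cos (m * t) - sin (m * (T + t)) * sin (m * t)"
    have j: "?j = 0"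
      using cos_add[of "m * (T - t)" "m * t"] cos_diff[of "m * (T + t)" "m * t"]
      by (simp add: algebra_simps)
    have "(x has_real_derivative (m * (sin (m * (T - t)) * C t + cos (m * (T - t)) * S t
     - sin (m * (T + t)) * (C T - C t) + cos (m * (T + t)) * (S T - S t)) + f t * ?j)
       / (2 * m * sin (m * T))) (at t within ?I)"
      unfolding x_def
      by (rule DERIV_cdivide, (rule derivative_eq_intros dC[OF t] dS[OF t] refl)+)
         (simp add: algebra_simps)
    then show ?thesis unfolding j x'_def using m ns by simp
  qed
  have dx': "(x' has_real_derivative f t - m^2 * x t) (at t within ?I)" if t: "t \<in> ?I" for t
  proof -
    let ?j = "sin (m * (T - t)) * cos (m * t) + cos (m * (T - t)) * sin (m * t)
       + sin (m * (T + t)) * cos (m * t) - cos (m * (T + t)) * sin (m * t)"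
    have j: "?j = 2 * sin (m * T)"
      using sin_add[of "m * (T - t)" "m * t"] sin_diff[of "m * (T + t)" "m * t"]
      by (simp add: algebra_simps)
    have "(x' has_real_derivative (f t * ?j - m * (cos (m * (T - t)) * C t - sin (m * (T - t)) * S t
     + cos (m * (T + t)) * (C T - C t) + sin (m * (T + t)) * (S T - S t)))
       / (2 * sin (m * T))) (at t within ?I)"
      unfolding x'_def
      by (rule DERIV_cdivide, (rule derivative_eq_intros dC[OF t] dS[OF t] refl)+)
         (simp add: algebra_simps)
    then show ?thesis unfolding j x_def using m ns
      by (simp add: diff_divide_distrib power2_eq_square)
  qed
  have [simp]: "C (-T) = 0" "S (-T) = 0" unfolding C_def S_def by simp_all
  have "x T = x (-T)" "x' T = x' (-T)" unfolding x_def x'_def by simp_all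
  moreover have "((\<lambda>t. integral ?I (\<lambda>s. cos_green T m (t, s) * f s)) has_real_derivative x' t)
      (at t within ?I)" if "t \<in> ?I" for t
    by (rule has_field_derivative_transform_within[OF dx[OF that], of 1]) (use that x in auto)
  ultimately show ?thesis
    unfolding periodic_solution_def using T dx' x
    by (intro exI[of _ x'] exI[of _ "\<lambda>t. f t - m^2 * x t"]) auto
qed

text \<open>
  The difference \<open>z\<close> of two solutions satisfies \<open>z'' = - m\<^sup>2 z\<close>, so the vector \<open>(m z, z')\<close> rotates at
  constant speed, and \<open>p\<close>, \<open>q\<close> below, its coordinates in the rotating frame, are constant. Comparing
  their values at \<open>T\<close> and \<open>-T\<close>, where \<open>z\<close> and \<open>z'\<close> agree, gives
  \<open>z'(T) sin (m T) = 0\<close> and \<open>m z(T) sin (m T) = 0\<close>; so \<open>z\<close> and \<open>z'\<close> vanish at \<open>T\<close>, and hence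
  both constants are \<open>0\<close>.
\<close>

lemma periodic_solution_unique:
  assumes T: "T > 0" and ns: "sin (m * T) \<noteq> 0"
    and x: "periodic_solution T m f x" and y: "periodic_solution T m f y" and t: "t \<in> {-T..T}"
  shows "x t = y t"
proof -
  let ?I = "{-T..T}"
  from ns have m: "m \<noteq> 0" by auto
  from x obtain x' x'' where
    dx: "\<And>t. t \<in> ?I \<Longrightarrow> (x has_real_derivative x' t) (at t within ?I)"
      "\<And>t. t \<in> ?I \<Longrightarrow> (x' has_real_derivative x'' t) (at t within ?I)"
    and ex: "\<And>t. t \<in> ?I \<Longrightarrow> x'' t = f t - m^2 * x t" and bx: "x T = x (-T)" "x' T = x' (-T)"
    unfolding periodic_solution_def by (metis add_diff_cancel_right')
  from y obtain y' y'' where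
    dy: "\<And>t. t \<in> ?I \<Longrightarrow> (y has_real_derivative y' t) (at t within ?I)"
      "\<And>t. t \<in> ?I \<Longrightarrow> (y' has_real_derivative y'' t) (at t within ?I)"
    and ey: "\<And>t. t \<in> ?I \<Longrightarrow> y'' t = f t - m^2 * y t" and b_y: "y T = y (-T)" "y' T = y' (-T)"
    unfolding periodic_solution_def by (metis add_diff_cancel_right')
  define z where "z = (\<lambda>t. x t - y t)"
  define z' where "z' = (\<lambda>t. x' t - y' t)"
  have dz: "(z has_real_derivative z' t) (at t within ?I)" if "t \<in> ?I" for t
    unfolding z_def z'_def using dx(1) dy(1) that by (intro derivative_intros) auto
  have dz': "(z' has_real_derivative - (m^2) * z t) (at t within ?I)" if "t \<in> ?I" for t
    unfolding z_def z'_def using dx(2)[OF that] dy(2)[OF that] ex[OF that] ey[OF that]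
    by (auto intro!: derivative_eq_intros simp: algebra_simps)
  define p where "p = (\<lambda>t. m * z t * cos (m * t) - z' t * sin (m * t))"
  define q where "q = (\<lambda>t. m * z t * sin (m * t) + z' t * cos (m * t))"
  have "(p has_real_derivative 0) (at t within ?I)" if "t \<in> ?I" for t
    unfolding p_def
    by (rule derivative_eq_intros dz[OF that] dz'[OF that] refl)+ (simp add: algebra_simps power2_eq_square)
  then have "\<exists>c. \<forall>t\<in>?I. p t = c" by (intro has_field_derivative_zero_constant) auto
  then obtain P where P: "\<And>t. t \<in> ?I \<Longrightarrow> p t = P" by blast
  have "(q has_real_derivative 0) (at t within ?I)" if "t \<in> ?I" for t
    unfolding q_def
    by (rule derivative_eq_intros dz[OF that] dz'[OF that] refl)+ (simp add: algebra_simps power2_eq_square)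
  then have "\<exists>c. \<forall>t\<in>?I. q t = c" by (intro has_field_derivative_zero_constant) auto
  then obtain Q where Q: "\<And>t. t \<in> ?I \<Longrightarrow> q t = Q" by blast
  have bz: "z (-T) = z T" "z' (-T) = z' T" unfolding z_def z'_def using bx b_y by auto
  have "p (-T) = p T" "q (-T) = q T" using P Q T by auto
  then have 0: "z T = 0" "z' T = 0" using ns m unfolding p_def q_def bz by simp_all
  then have PQ: "P = 0" "Q = 0" using P[of T] Q[of T] T unfolding p_def q_def by auto
  have "p t * cos (m * t) + q t * sin (m * t) = m * z t * ((cos (m * t))^2 + (sin (m * t))^2)"
    unfolding p_def q_def by algebra
  then have "z t = 0" using P[OF t] Q[OF t] PQ m by simp
  then show ?thesis by (simp add: z_def)
qed

lemma periodic_solution_cong: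
  assumes "\<And>t. t \<in> {-T..T} \<Longrightarrow> x t = y t" and T: "T > 0" and x: "periodic_solution T m f x"
  shows "periodic_solution T m f y"
proof -
  have "(y has_real_derivative d) (at t within {-T..T})"
    if "(x has_real_derivative d) (at t within {-T..T})" "t \<in> {-T..T}" for d t
    by (rule has_field_derivative_transform_within[OF that(1), of 1]) (use that assms in auto)
  moreover have "x T = y T" "x (-T) = y (-T)" using assms(1) T by auto
  ultimately show ?thesis using x assms(1) unfolding periodic_solution_def by metis
qed

lemma is_periodic_green_cos_green:
  assumes T: "T > 0" and ns: "sin (m * T) \<noteq> 0"
  shows "is_periodic_green T m (restrict (cos_green T m) ({-T..T} \<times> {-T..T}))"
proof -
  let ?I = "{-T..T}"
  let ?G = "restrict (cos_green T m) (?I \<times> ?I)"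
  have "periodic_solution T m f x \<longleftrightarrow>
      (\<forall>t\<in>?I. x t = integral ?I (\<lambda>s. ?G (t, s) * f s))" if f: "continuous_on ?I f" for f x
  proof -
    have eq: "integral ?I (\<lambda>s. ?G (t, s) * f s) = integral ?I (\<lambda>s. cos_green T m (t, s) * f s)"
      if "t \<in> ?I" for t
      using that by (intro Henstock_Kurzweil_Integration.integral_cong) auto
    note sol = periodic_solution_integral_cos_green[OF T ns f]
    show ?thesis
    proof
      assume "periodic_solution T m f x"
      then show "\<forall>t\<in>?I. x t = integral ?I (\<lambda>s. ?G (t, s) * f s)"
        using periodic_solution_unique[OF T ns _ sol] eq by simp
    next
      assume "\<forall>t\<in>?I. x t = integral ?I (\<lambda>s. ?G (t, s) * f s)"
      then show "periodic_solution T m f x"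
        using eq by (intro periodic_solution_cong[OF _ T sol]) auto
    qed
  qed
  moreover have "continuous_on (?I \<times> ?I) ?G"
    using continuous_on_cos_green by (rule continuous_on_eq) auto
  ultimately show ?thesis
    unfolding is_periodic_green_def by (intro conjI allI impI restrict_extensional)
qed

lemma is_periodic_greenD:
  assumes "is_periodic_green T m G"
  shows "G \<in> extensional ({-T..T} \<times> {-T..T})"
    and "continuous_on ({-T..T} \<times> {-T..T}) G"
    and "continuous_on {-T..T} f \<Longrightarrow> periodic_solution T m f x \<longleftrightarrow>
           (\<forall>t\<in>{-T..T}. x t = integral {-T..T} (\<lambda>s. G (t, s) * f s))"
proof -
  note G = assms[unfolded is_periodic_green_def]
  show "G \<in> extensional ({-T..T} \<times> {-T..T})" using G by (rule conjunct1)
  show "continuous_on ({-T..T} \<times> {-T..T}) G" by (rule G[THEN conjunct2, THEN conjunct1])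
  show "continuous_on {-T..T} f \<Longrightarrow> periodic_solution T m f x \<longleftrightarrow>
           (\<forall>t\<in>{-T..T}. x t = integral {-T..T} (\<lambda>s. G (t, s) * f s))"
    by (rule G[THEN conjunct2, THEN conjunct2, THEN spec, THEN mp, THEN spec])
qed

text \<open>
  Integrating two kernels against a continuous \<open>f\<close> gives the same function on the interval, as both
  integrals are the solution for \<open>f\<close>. Choosing \<open>f\<close> to be the difference of the kernels for a
  fixed \<open>t\<close> shows that the integral of its square is \<open>0\<close>.
\<close>

lemma is_periodic_green_unique:
  assumes T: "T > 0" and G: "is_periodic_green T m G" and H: "is_periodic_green T m H"
  shows "G = H"
proof -
  let ?I = "{-T..T}"
  note cont = is_periodic_greenD(2)[OF G] is_periodic_greenD(2)[OF H]
  have "G (t, s) = H (t, s)" if t: "t \<in> ?I" and s: "s \<in> ?I" for t s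
  proof -
    have sub: "continuous_on ?I (\<lambda>s. K (t, s))"
      if "continuous_on (?I \<times> ?I) K" for K :: "real \<times> real \<Rightarrow> real"
      by (rule continuous_on_compose2[OF that]) (use t in \<open>auto intro!: continuous_intros\<close>)
    define f where "f = (\<lambda>s. G (t, s) - H (t, s))"
    have f: "continuous_on ?I f" unfolding f_def by (intro continuous_intros sub cont)
    have "periodic_solution T m f (\<lambda>t. integral ?I (\<lambda>s. G (t, s) * f s))"
      using is_periodic_greenD(3)[OF G f] by simp
    then have "\<forall>u\<in>?I. integral ?I (\<lambda>s. G (u, s) * f s) = integral ?I (\<lambda>s. H (u, s) * f s)"
      by (rule is_periodic_greenD(3)[OF H f, THEN iffD1])
    then have e: "integral ?I (\<lambda>s. G (t, s) * f s) = integral ?I (\<lambda>s. H (t, s) * f s)"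
      using t by (rule bspec)
    have "integral ?I (\<lambda>s. f s * f s) =
        integral ?I (\<lambda>s. G (t, s) * f s) - integral ?I (\<lambda>s. H (t, s) * f s)"
      unfolding f_def left_diff_distrib
      by (intro Henstock_Kurzweil_Integration.integral_diff integrable_continuous_real
          continuous_intros sub cont)
    then have "integral ?I (\<lambda>s. f s * f s) = 0" using e by simp
    then have "((\<lambda>s. f s * f s) has_integral 0) (cbox (-T) T)"
      using f by (simp add: has_integral_iff integrable_continuous_real continuous_on_mult)
    then have "f s * f s = 0"
      using f s T by (intro has_integral_0_cbox_imp_0[of "-T" T]) (auto intro!: continuous_intros)
    then show ?thesis by (simp add: f_def)
  qed
  then show ?thesis
    by (intro extensionalityI[OF is_periodic_greenD(1)[OF G] is_periodic_greenD(1)[OF H]]) auto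
qed

lemma periodic_green_eq:
  assumes "T > 0" "sin (m * T) \<noteq> 0"
  shows "periodic_green T m = restrict (cos_green T m) ({-T..T} \<times> {-T..T})"
  unfolding periodic_green_def
  by (intro the_equality is_periodic_green_cos_green assms)
     (rule is_periodic_green_unique[OF assms(1) _ is_periodic_green_cos_green[OF assms]])

section \<open>The Green's function of the problem with reflection\<close>

text \<open>
  On the diagonal the branch depends on the sign of \<open>m\<close>: the limit \<open>s \<rightarrow> t+\<close>, taken for
  \<open>m > 0\<close>, belongs to the branch \<open>s > t\<close>, and the limit \<open>s \<rightarrow> t-\<close>, taken for \<open>m < 0\<close>, to the
  branch \<open>s < t\<close>.
\<close>

definition refl_kernel :: "real \<Rightarrow> real \<Rightarrow> real \<Rightarrow> real \<Rightarrow> real" where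
  "refl_kernel T m t s =
     (cos (m * (T - \<bar>t + s\<bar>)) +
      (if s < t \<or> s = t \<and> m < 0 then sin (m * (T - (t - s))) else - sin (m * (T - (s - t)))))
     / (2 * sin (m * T))"

lemma refl_green_offdiag_eq:
  assumes T: "T > 0" and ns: "sin (m * T) \<noteq> 0" and t: "t \<in> {-T..T}" and s: "s \<in> {-T..T}"
    and ts: "t \<noteq> s"
  shows "refl_green_offdiag T m t s = refl_kernel T m t s"
proof -
  let ?I = "{-T..T}"
  let ?d = "(if s < t then - sin (m * (T - (t - s))) else sin (m * (T - (s - t)))) / (2 * sin (m * T))"
  from ns have m: "m \<noteq> 0" by auto
  \<comment> \<open>Near \<open>s \<noteq> t\<close> the absolute value has a fixed sign, and the kernel is differentiable there.\<close>
  have abs: "eventually (\<lambda>r. \<bar>t - r\<bar> = (if s < t then t - r else r - t)) (nhds s)"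
  proof (cases "s < t")
    case True
    then have "eventually (\<lambda>r. r < t) (nhds s)" by (intro order_tendstoD(2)[OF filterlim_ident])
    then show ?thesis by eventually_elim (use True in auto)
  next
    case False
    then have "eventually (\<lambda>r. t < r) (nhds s)" using ts by (intro order_tendstoD(1)[OF filterlim_ident]) auto
    then show ?thesis by eventually_elim (use False in auto)
  qed
  let ?h = "\<lambda>r. cos (m * (T - (if s < t then t - r else r - t))) / (2 * m * sin (m * T))"
  have "(?h has_real_derivative ?d) (at s)"
    using m ns by (cases "s < t") (auto intro!: derivative_eq_intros simp: field_simps)
  moreover have "eventually (\<lambda>r. ?h r = cos_green T m (t, r)) (nhds s)"
    using abs by eventually_elim (simp add: cos_green_def)
  ultimately have "((\<lambda>r. cos_green T m (t, r)) has_real_derivative ?d) (at s)"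
    by (subst (asm) DERIV_cong_ev[OF refl _ refl]) auto
  then have "((\<lambda>r. cos_green T m (t, r)) has_real_derivative ?d) (at s within ?I)"
    by (rule has_field_derivative_at_within)
  then have "((\<lambda>r. periodic_green T m (t, r)) has_real_derivative ?d) (at s within ?I)"
    by (rule has_field_derivative_transform_within[of _ _ _ _ 1])
       (use s t in \<open>auto simp: periodic_green_eq[OF T ns]\<close>)
  then have "vector_derivative (\<lambda>r. periodic_green T m (t, r)) (at s within cbox (-T) T) = ?d"
    using s T by (intro vector_derivative_within_cbox)
       (auto simp: has_real_derivative_iff_has_vector_derivative)
  then have "refl_green_offdiag T m t s = m * cos_green T m (t, -s) - ?d"
    unfolding refl_green_offdiag_def using s t by (simp add: periodic_green_eq[OF T ns])
  also have "m * cos_green T m (t, -s) = cos (m * (T - \<bar>t + s\<bar>)) / (2 * sin (m * T))"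
    using m by (simp add: cos_green_def)
  also have "\<dots> - ?d = refl_kernel T m t s"
    using ts unfolding refl_kernel_def by (auto simp: add_divide_distrib diff_divide_distrib)
  finally show ?thesis .
qed

lemma refl_green_diag_eq:
  assumes T: "T > 0" and ns: "sin (m * T) \<noteq> 0" and t: "t \<in> {-T<..<T}"
  shows "refl_green_diag T m t = refl_kernel T m t t"
proof -
  from ns have "m \<noteq> 0" by auto
  then consider "m > 0" | "m < 0" by linarith
  then show ?thesis
  proof cases
    case 1
    have "((\<lambda>s. (cos (m * (T - \<bar>t + s\<bar>)) - sin (m * (T - (s - t)))) / (2 * sin (m * T)))
        \<longlongrightarrow> (cos (m * (T - \<bar>t + t\<bar>)) - sin (m * (T - (t - t)))) / (2 * sin (m * T))) (at_right t)"
      using ns by (intro tendsto_intros) auto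
    moreover have "eventually (\<lambda>s. (cos (m * (T - \<bar>t + s\<bar>)) - sin (m * (T - (s - t)))) / (2 * sin (m * T))
        = refl_green_offdiag T m t s) (at_right t)"
      using eventually_at_right_real[of t T] t
      by (auto elim!: eventually_mono simp: refl_green_offdiag_eq[OF T ns] refl_kernel_def)
    ultimately have "((\<lambda>s. refl_green_offdiag T m t s) \<longlongrightarrow>
        (cos (m * (T - \<bar>t + t\<bar>)) - sin (m * (T - (t - t)))) / (2 * sin (m * T))) (at_right t)"
      by (rule Lim_transform_eventually)
    then show ?thesis
      using 1 by (simp add: refl_green_diag_def refl_kernel_def tendsto_Lim)
  next
    case 2
    have "((\<lambda>s. (cos (m * (T - \<bar>t + s\<bar>)) + sin (m * (T - (t - s)))) / (2 * sin (m * T)))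
        \<longlongrightarrow> (cos (m * (T - \<bar>t + t\<bar>)) + sin (m * (T - (t - t)))) / (2 * sin (m * T))) (at_left t)"
      using ns by (intro tendsto_intros) auto
    moreover have "eventually (\<lambda>s. (cos (m * (T - \<bar>t + s\<bar>)) + sin (m * (T - (t - s)))) / (2 * sin (m * T))
        = refl_green_offdiag T m t s) (at_left t)"
      using eventually_at_left_real[of "-T" t] t
      by (auto elim!: eventually_mono simp: refl_green_offdiag_eq[OF T ns] refl_kernel_def)
    ultimately have "((\<lambda>s. refl_green_offdiag T m t s) \<longlongrightarrow>
        (cos (m * (T - \<bar>t + t\<bar>)) + sin (m * (T - (t - t)))) / (2 * sin (m * T))) (at_left t)"
      by (rule Lim_transform_eventually)
    then show ?thesis
      using 2 by (simp add: refl_green_diag_def refl_kernel_def tendsto_Lim)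
  qed
qed

text \<open>
  Along the diagonal the closed form is continuous up to the corners, so that the limits defining the
  two corner values are those of the closed form as well.
\<close>

lemma refl_green_eq_refl_kernel:
  assumes T: "T > 0" and ns: "sin (m * T) \<noteq> 0" and t: "t \<in> {-T..T}" and s: "s \<in> {-T..T}"
  shows "refl_green T m (t, s) = refl_kernel T m t s"
proof -
  have diag: "isCont (\<lambda>u. refl_kernel T m u u) v" for v
    unfolding refl_kernel_def using ns by (cases "m < 0") (auto intro!: continuous_intros)
  have ev: "eventually (\<lambda>u. refl_kernel T m u u = refl_green_diag T m u) (at_left T)"
      "eventually (\<lambda>u. refl_kernel T m u u = refl_green_diag T m u) (at_right (-T))"
    using eventually_at_left_real[of "-T" T] eventually_at_right_real[of "-T" T] T
    by (auto elim!: eventually_mono simp: refl_green_diag_eq[OF T ns])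
  have "(refl_green_diag T m \<longlongrightarrow> refl_kernel T m T T) (at_left T)"
    using diag[of T] ev(1) by (intro Lim_transform_eventually[OF _ ev(1)])
      (auto simp: isCont_def intro: tendsto_within_subset)
  then have R: "Lim (at_left T) (refl_green_diag T m) = refl_kernel T m T T"
    by (intro tendsto_Lim) auto
  have "(refl_green_diag T m \<longlongrightarrow> refl_kernel T m (-T) (-T)) (at_right (-T))"
    using diag[of "-T"] by (intro Lim_transform_eventually[OF _ ev(2)])
      (auto simp: isCont_def intro: tendsto_within_subset)
  then have L: "Lim (at_right (-T)) (refl_green_diag T m) = refl_kernel T m (-T) (-T)"
    by (intro tendsto_Lim) auto
  show ?thesis
    using t s L R refl_green_offdiag_eq[OF T ns t s] refl_green_diag_eq[OF T ns, of t]
    unfolding refl_green_def by auto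
qed

section \<open>The sign of the Green's function\<close>

text \<open>
  This transfers every result for positive \<open>m\<close> to negative \<open>m\<close>. The reflection at the origin exchanges
  the two sides of the diagonal, and the change of sign of \<open>m\<close> exchanges the one-sided limits that
  define the diagonal values, so the identity holds on the diagonal too.
\<close>

lemma refl_kernel_minus:
  assumes "m \<noteq> 0"
  shows "refl_kernel T (-m) t s = - refl_kernel T m (-t) (-s)"
proof -
  have "- t - s = - (t + s)" by simp
  then have "\<bar>- t - s\<bar> = \<bar>t + s\<bar>" by (metis abs_minus_cancel)
  then show ?thesis using assms by (auto simp: refl_kernel_def)
qed

text \<open>
  Writing \<open>sin y\<close> as \<open>- cos (y + \<pi>/2)\<close> turns the claim into the monotonicity of the cosine on
  \<open>[0, \<pi>]\<close>: \<open>\<bar>x\<bar> \<le> \<alpha> \<le> \<pi>/2 - \<alpha> \<le> y + \<pi>/2\<close>, and equality of the two ends makes every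
  inequality in this chain an equality.
\<close>

lemma cos_add_sin_nonneg:
  fixes \<alpha> x y :: real
  assumes \<alpha>: "\<alpha> \<le> pi / 4" and x: "\<bar>x\<bar> \<le> \<alpha>" and y: "\<bar>y\<bar> \<le> \<alpha>"
  shows "0 \<le> cos x + sin y"
    and "cos x + sin y = 0 \<longleftrightarrow> \<alpha> = pi / 4 \<and> \<bar>x\<bar> = \<alpha> \<and> y = - \<alpha>"
proof -
  have eq: "cos x + sin y = cos \<bar>x\<bar> - cos (y + pi / 2)"
    by (simp add: cos_add)
  have le: "0 \<le> \<bar>x\<bar>" "\<bar>x\<bar> \<le> y + pi / 2" "y + pi / 2 \<le> pi"
    using assms by auto
  show "0 \<le> cos x + sin y"
    using cos_monotone_0_pi_le[OF le] unfolding eq by linarith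
  have "cos x + sin y = 0 \<longleftrightarrow> cos \<bar>x\<bar> = cos (y + pi / 2)"
    unfolding eq by linarith
  also have "\<dots> \<longleftrightarrow> \<bar>x\<bar> = y + pi / 2"
  proof
    assume "cos \<bar>x\<bar> = cos (y + pi / 2)"
    then show "\<bar>x\<bar> = y + pi / 2" 
      using le by - (rule cos_inj_pi, linarith+)
  qed (simp only:)
  also have "\<dots> \<longleftrightarrow> \<alpha> = pi / 4 \<and> \<bar>x\<bar> = \<alpha> \<and> y = - \<alpha>"
    using assms by linarith
  finally show "cos x + sin y = 0 \<longleftrightarrow> \<alpha> = pi / 4 \<and> \<bar>x\<bar> = \<alpha> \<and> y = - \<alpha>" .
qed

text \<open>
  With \<open>x = m a\<close> and \<open>y = m b\<close> as below, a zero requires \<open>\<bar>a\<bar> = T\<close> and \<open>b = -T\<close>. Below the diagonal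
  the second equation leaves only the corner \<open>(T, -T)\<close>; on and above it, it means \<open>s = t\<close>, and then the
  first one says \<open>\<bar>2 t\<bar> \<in> {0, 2 T}\<close>.
\<close>

lemma refl_kernel_nonneg:
  assumes T: "T > 0" and m: "m > 0" and mT: "m * T \<le> pi / 4"
    and t: "t \<in> {-T..T}" and s: "s \<in> {-T..T}"
  shows "0 \<le> refl_kernel T m t s"
    and "refl_kernel T m t s = 0 \<longleftrightarrow> m * T = pi / 4 \<and> (t, s) \<in> zero_points T"
proof -
  define a where "a = T - \<bar>t + s\<bar>"
  define b where "b = (if s < t then T - (t - s) else (s - t) - T)"
  have ab: "\<bar>a\<bar> \<le> T" "\<bar>b\<bar> \<le> T" using t s by (auto simp: a_def b_def)
  have mab: "\<bar>m * a\<bar> \<le> m * T" "\<bar>m * b\<bar> \<le> m * T"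
    using ab m by (simp_all add: abs_mult)
  have sin: "sin (m * T) > 0" using T m mT pi_gt_zero by (intro sin_gt_zero) (simp, linarith)
  have "m * b = - (m * (T - (s - t)))" if "\<not> s < t"
    using that by (simp add: b_def algebra_simps)
  then have eq: "refl_kernel T m t s = (cos (m * a) + sin (m * b)) / (2 * sin (m * T))"
    using m unfolding refl_kernel_def by (cases "s < t") (simp_all add: a_def b_def)
  show "0 \<le> refl_kernel T m t s"
    unfolding eq using cos_add_sin_nonneg(1)[OF mT mab] sin by simp
  have "refl_kernel T m t s = 0 \<longleftrightarrow> cos (m * a) + sin (m * b) = 0"
    unfolding eq using sin by simp
  also have "\<dots> \<longleftrightarrow> m * T = pi / 4 \<and> \<bar>m * a\<bar> = m * T \<and> m * b = - (m * T)"
    by (rule cos_add_sin_nonneg(2)[OF mT mab])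
  also have "\<dots> \<longleftrightarrow> m * T = pi / 4 \<and> \<bar>a\<bar> = T \<and> b = - T"
  proof -
    have "\<bar>m * a\<bar> = m * T \<longleftrightarrow> \<bar>a\<bar> = T" using m by (simp add: abs_mult)
    moreover have "m * b = - (m * T) \<longleftrightarrow> b = - T"
      using m mult_cancel_left[of m b "- T"] by simp
    ultimately show ?thesis by simp
  qed
  also have "\<bar>a\<bar> = T \<and> b = - T \<longleftrightarrow> (t, s) \<in> zero_points T"
  proof (cases "s < t")
    case True
    then have "b = - T \<longleftrightarrow> t = T \<and> s = - T" using t s by (auto simp: b_def)
    then show ?thesis using T True by (auto simp: a_def zero_points_def)
  next
    case False
    then have "b = - T \<longleftrightarrow> s = t" by (auto simp: b_def)
    moreover have "\<bar>a\<bar> = T \<longleftrightarrow> t = 0 \<or> t = T \<or> t = - T" if "s = t"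
      using that t unfolding a_def by auto
    ultimately show ?thesis using T False by (auto simp: zero_points_def)
  qed
  finally show "refl_kernel T m t s = 0 \<longleftrightarrow> m * T = pi / 4 \<and> (t, s) \<in> zero_points T" .
qed

text \<open>
  The point \<open>(T, 0)\<close> has numerator \<open>cos 0 + sin 0 = 1\<close>. At \<open>(0, s)\<close> with \<open>s > 0\<close> the numerator is
  \<open>cos \<theta> - sin \<theta>\<close> for \<open>\<theta> = m (T - s)\<close>, which ranges over \<open>[0, m T)\<close> and so takes values just
  above \<open>\<pi>/4\<close>, where this is negative. Opposite signs of the numerators suffice, whatever the sign of
  the common denominator \<open>2 sin (m T)\<close>.
\<close>

lemma refl_kernel_changes_sign:
  assumes T: "T > 0" and ns: "sin (m * T) \<noteq> 0" and mT: "m * T > pi / 4"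
  shows "\<exists>t\<in>{-T..T}. \<exists>s\<in>{-T..T}. refl_kernel T m t s > 0"
    and "\<exists>t\<in>{-T..T}. \<exists>s\<in>{-T..T}. refl_kernel T m t s < 0"
proof -
  have m: "m > 0" using T mT pi_gt_zero by (metis less_trans divide_pos_pos zero_less_numeral zero_less_mult_pos2)
  have "\<exists>\<theta>. pi / 4 < \<theta> \<and> \<theta> \<le> pi / 2 \<and> \<theta> < a" if "pi / 4 < a" for a
    using that by (intro exI[of _ "min (pi / 2) ((a + pi / 4) / 2)"]) (simp add: min_def)
  then obtain \<theta> where \<theta>: "pi / 4 < \<theta>" "\<theta> \<le> pi / 2" "\<theta> < m * T" using mT by blast
  \<comment> \<open>The cosine at \<open>\<pi>/2 - \<theta>\<close> is \<open>sin \<theta>\<close>, so this compares cosine and sine at \<open>\<theta>\<close>.\<close>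
  have "cos \<theta> < cos (pi / 2 - \<theta>)" using \<theta> by (intro cos_monotone_0_pi) auto
  then have neg: "cos \<theta> - sin \<theta> < 0" by (simp add: cos_diff)
  define s where "s = T - \<theta> / m"
  have \<theta>m: "0 < \<theta> / m" "\<theta> / m < T" using \<theta> m pi_gt_zero by (simp_all add: field_simps)
  then have s: "0 < s" "s < T" by (auto simp: s_def)
  have "refl_kernel T m 0 s = (cos \<theta> - sin \<theta>) / (2 * sin (m * T))"
    using s(1) m by (simp add: refl_kernel_def) (simp add: s_def)
  moreover have "refl_kernel T m T 0 = 1 / (2 * sin (m * T))"
    using T by (simp add: refl_kernel_def)
  ultimately have val: "sgn (refl_kernel T m 0 s) = - sgn (sin (m * T))"
      "sgn (refl_kernel T m T 0) = sgn (sin (m * T))"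
    using neg by (simp_all add: sgn_divide sgn_mult)
  have mem: "0 \<in> {-T..T}" "s \<in> {-T..T}" "T \<in> {-T..T}" using T s by auto
  show "\<exists>t\<in>{-T..T}. \<exists>s\<in>{-T..T}. refl_kernel T m t s > 0"
  proof (cases "sin (m * T) > 0")
    case True
    then have "refl_kernel T m T 0 > 0" using val(2) by (simp add: sgn_1_pos)
    then show ?thesis using mem by blast
  next
    case False
    then have "refl_kernel T m 0 s > 0" using val(1) ns by (simp add: sgn_1_pos)
    then show ?thesis using mem by blast
  qed
  show "\<exists>t\<in>{-T..T}. \<exists>s\<in>{-T..T}. refl_kernel T m t s < 0"
  proof (cases "sin (m * T) > 0")
    case True
    then have "refl_kernel T m 0 s < 0" using val(1) by (simp add: sgn_1_neg)
    then show ?thesis using mem by blast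
  next
    case False
    then have "refl_kernel T m T 0 < 0" using val(2) ns by (simp add: sgn_1_neg)
    then show ?thesis using mem by blast
  qed
qed

theorem theorem4p3:
  fixes T m \<alpha> :: real
  assumes T: "T > 0"
    and m: "\<forall>k::int. m \<noteq> of_int k * pi / T"
    and \<alpha>: "\<alpha> = m * T"
  shows "(\<alpha> \<in> {0<..<pi/4} \<longrightarrow> (\<forall>p \<in> {-T..T} \<times> {-T..T}. refl_green T m p > 0))
    \<and> (\<alpha> \<in> {-pi/4<..<0} \<longrightarrow> (\<forall>p \<in> {-T..T} \<times> {-T..T}. refl_green T m p < 0))
    \<and> (\<alpha> = pi/4 \<longrightarrow>
         (\<forall>p \<in> zero_points T. refl_green T m p = 0) \<and>
         (\<forall>p \<in> {-T..T} \<times> {-T..T} - zero_points T. refl_green T m p > 0))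
    \<and> (\<alpha> = -pi/4 \<longrightarrow>
         (\<forall>p \<in> zero_points_refl T. refl_green T m p = 0) \<and>
         (\<forall>p \<in> {-T..T} \<times> {-T..T} - zero_points_refl T. refl_green T m p < 0))
    \<and> (\<alpha> \<notin> {-pi/4..pi/4} \<longrightarrow>
         \<not> (\<forall>p \<in> {-T..T} \<times> {-T..T}. refl_green T m p \<ge> 0) \<and>
         \<not> (\<forall>p \<in> {-T..T} \<times> {-T..T}. refl_green T m p \<le> 0))"
proof -
  have ns: "sin (m * T) \<noteq> 0"
  proof
    assume "sin (m * T) = 0"
    then obtain k :: int where "m * T = of_int k * pi" unfolding sin_zero_iff_int2 by auto
    then have "m = of_int k * pi / T" using T by (simp add: field_simps)
    then show False using m by blast
  qed
  then have m0: "m \<noteq> 0" and ns': "sin (- m * T) \<noteq> 0" by auto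
  let ?I = "{-T..T}"
  note eq = refl_green_eq_refl_kernel[OF T ns]
  have refl: "refl_green T m (t, s) = - refl_kernel T (- m) (- t) (- s)"
    if "t \<in> ?I" "s \<in> ?I" for t s
    using eq[OF that] refl_kernel_minus[of "-m" T t s] m0 by simp
  have pos: "refl_green T m p \<ge> 0"
      "refl_green T m p = 0 \<longleftrightarrow> \<alpha> = pi / 4 \<and> p \<in> zero_points T"
    if "\<alpha> \<in> {0<..pi/4}" "p \<in> ?I \<times> ?I" for p
  proof -
    have "m > 0" using that(1) T \<alpha> by (simp add: zero_less_mult_iff)
    then show "refl_green T m p \<ge> 0"
      "refl_green T m p = 0 \<longleftrightarrow> \<alpha> = pi / 4 \<and> p \<in> zero_points T"
      using refl_kernel_nonneg[OF T, of m "fst p" "snd p"] eq[of "fst p" "snd p"] that \<alpha> by auto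
  qed
  have neg: "refl_green T m p \<le> 0"
      "refl_green T m p = 0 \<longleftrightarrow> \<alpha> = - pi / 4 \<and> p \<in> zero_points_refl T"
    if range: "\<alpha> \<in> {-pi/4..<0}" and mem: "p \<in> ?I \<times> ?I" for p
  proof -
    obtain t s where p: "p = (t, s)" "t \<in> ?I" "s \<in> ?I" using mem by (rule SigmaE)
    have "- m > 0" using range T \<alpha> by (simp add: mult_less_0_iff)
    note K = refl_kernel_nonneg[OF T this, of "- t" "- s"]
    have Z: "(- t, - s) \<in> zero_points T \<longleftrightarrow> (t, s) \<in> zero_points_refl T"
      unfolding zero_points_def zero_points_refl_def by auto
    show "refl_green T m p \<le> 0"
      "refl_green T m p = 0 \<longleftrightarrow> \<alpha> = - pi / 4 \<and> p \<in> zero_points_refl T"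
      using K refl[OF p(2,3)] p range \<alpha> Z by auto
  qed
  have osc: "\<not> (\<forall>p \<in> ?I \<times> ?I. refl_green T m p \<ge> 0) \<and> \<not> (\<forall>p \<in> ?I \<times> ?I. refl_green T m p \<le> 0)"
    if "\<alpha> \<notin> {-pi/4..pi/4}"
  proof -
    have "(\<exists>p \<in> ?I \<times> ?I. refl_green T m p > 0) \<and> (\<exists>p \<in> ?I \<times> ?I. refl_green T m p < 0)"
    proof (cases "\<alpha> > pi / 4")
      case True
      then have mT: "m * T > pi / 4" using \<alpha> by simp
      obtain t s t' s' where "t \<in> ?I" "s \<in> ?I" "refl_kernel T m t s > 0"
          and "t' \<in> ?I" "s' \<in> ?I" "refl_kernel T m t' s' < 0"
        using refl_kernel_changes_sign[OF T ns mT] by blast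
      then show ?thesis
        by (intro conjI bexI[of _ "(t, s)"] bexI[of _ "(t', s')"]) (simp_all add: eq)
    next
      case False
      then have mT: "- m * T > pi / 4" using that \<alpha> by auto
      obtain t s t' s' where "t \<in> ?I" "s \<in> ?I" "refl_kernel T (- m) t s < 0"
          and "t' \<in> ?I" "s' \<in> ?I" "refl_kernel T (- m) t' s' > 0"
        using refl_kernel_changes_sign[OF T ns' mT] by blast
      then show ?thesis
        by (intro conjI bexI[of _ "(- t, - s)"] bexI[of _ "(- t', - s')"]) (simp_all add: refl)
    qed
    then show ?thesis by (meson not_le)
  qed
  have quarter: "pi/4 \<in> {0<..pi/4}" "-pi/4 \<in> {-pi/4..<0}" by simp_all
  have zero: "zero_points T \<subseteq> ?I \<times> ?I" "zero_points_refl T \<subseteq> ?I \<times> ?I"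
    using T unfolding zero_points_def zero_points_refl_def by auto
  show ?thesis
  proof (intro conjI impI ballI)
    fix p assume "\<alpha> \<in> {0<..<pi/4}" "p \<in> ?I \<times> ?I"
    then show "refl_green T m p > 0" using pos[of p] by auto
  next
    fix p assume "\<alpha> \<in> {-pi/4<..<0}" "p \<in> ?I \<times> ?I"
    then show "refl_green T m p < 0" using neg[of p] by auto
  next
    fix p assume "\<alpha> = pi/4" "p \<in> zero_points T"
    moreover from this have "\<alpha> \<in> {0<..pi/4}" using quarter by (simp only:)
    ultimately show "refl_green T m p = 0" using pos(2)[of p] zero(1) by blast
  next
    fix p assume "\<alpha> = pi/4" "p \<in> ?I \<times> ?I - zero_points T"
    moreover from this have "\<alpha> \<in> {0<..pi/4}" using quarter by (simp only:)
    ultimately show "refl_green T m p > 0" using pos[of p] by (simp add: order_less_le)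
  next
    fix p assume "\<alpha> = -pi/4" "p \<in> zero_points_refl T"
    moreover from this have "\<alpha> \<in> {-pi/4..<0}" using quarter by (simp only:)
    ultimately show "refl_green T m p = 0" using neg(2)[of p] zero(2) by blast
  next
    fix p assume "\<alpha> = -pi/4" "p \<in> ?I \<times> ?I - zero_points_refl T"
    moreover from this have "\<alpha> \<in> {-pi/4..<0}" using quarter by (simp only:)
    ultimately show "refl_green T m p < 0" using neg[of p] by (simp add: order_less_le)
  qed (use osc in blast)+
qed

end
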